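(* Let $\mathcal{G}$ be an edge-weighted graph (as in the context). (i) Suppose $\overline{\mathcal{G}}$ is weakly connected. If $x$ and $y$ are distinct points of $\overline{\mathcal{G}}$, there is a function $\phi\in\mathbb{A}$ whose range is $\{0,1\}$ such that $\phi(z)=0$ for $z$ in an open neighborhood $U$ of $x$, and $\phi(z)=1$ for $z$ in an open neighborhood $V$ of $y$. (ii) Conversely, if $\mathbb{A}$ separates points of $\overline{\mathcal{G}}$, then $\overline{\mathcal{G}}$ is weakly connected.
   Context: Graphs. $\mathcal{G}$ is a simple graph with countable vertex set $\mathcal{V}$ and countable edge set $\mathcal{E}$; each vertex has at least one and at most finitely many incident edges. Each edge $[u,v]\in\mathcal{E}$ has a length $R(u,v)=R(v,u)\in(0,\infty)$. Metric and completion. A finite path from $u$ to $v$ is a finite sequence of vertices $u=v_0,\dots,v_K=v$ with $[v_k,v_{k+1}]\in\mathcal{E}$. $d(u,v)=\inf_\gamma\sum_k R(v_k,v_{k+1})$, the infimum over finite paths $\gamma$ from $u$ to $v$ ($\infty$ if there is none). As a metric space $\mathcal{G}$ is identified with its vertex set, and $\overline{\mathcal{G}}$ is the metric completion. Paths in the completion. A path is a sequence $\{v_k\}$ of vertices with $[v_k,v_{k+1}]\in\mathcal{E}$, indexed by a finite set, by the positive integers (a ray), or by the integers (a double ray). It goes from $u\in\overline{\mathcal{G}}$ to $v\in\overline{\mathcal{G}}$ if it starts at $u$ (or, when infinite in that direction, converges to $u$) and ends at $v$ (or, when infinite in that direction, converges to $v$). Weakly connected. $\overline{\mathcal{G}}$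 is weakly connected if for every pair of distinct points $u,v\in\overline{\mathcal{G}}$ there is a finite set $W$ of edges such that every path from $u$ to $v$ contains an edge from $W$. The algebra $\mathbb{A}$. $\mathbb{A}$ is the real algebra (pointwise operations) of functions $\phi:\mathcal{V}\to\mathbb{R}$ such that the set of edges $[u,v]\in\mathcal{E}$ with $\phi(u)\neq\phi(v)$ is finite. Every $\phi\in\mathbb{A}$ extends (uniquely) to a continuous function on $\overline{\mathcal{G}}$, and $\phi$ is identified with this extension. *)

theory Defs
  imports "HOL-Analysis.Analysis"
begin

(* The edge [u,v] is the two-element set {u,v}. *)
record 'a wgraph =
  verts :: "'a set"
  edges :: "'a set set"
  len :: "'a \<Rightarrow> 'a \<Rightarrow> real"

locale weighted_graph =
  fixes G :: "'a wgraph"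
  assumes countable_verts: "countable (verts G)"
    and countable_edges: "countable (edges G)"
    and simple_edges: "e \<in> edges G \<Longrightarrow> \<exists>u\<in>verts G. \<exists>v\<in>verts G. u \<noteq> v \<and> e = {u, v}"
    and incident_nonempty: "v \<in> verts G \<Longrightarrow> {e \<in> edges G. v \<in> e} \<noteq> {}"
    and incident_finite: "v \<in> verts G \<Longrightarrow> finite {e \<in> edges G. v \<in> e}"
    and len_pos: "{u, v} \<in> edges G \<Longrightarrow> 0 < len G u v"
    and len_sym: "{u, v} \<in> edges G \<Longrightarrow> len G u v = len G v u"

definition walk :: "'a wgraph \<Rightarrow> 'a list \<Rightarrow> bool" where
  "walk G xs \<longleftrightarrow> xs \<noteq> [] \<and> set xs \<subseteq> verts G \<and>
     (\<forall>k. Suc k < length xs \<longrightarrow> {xs ! k, xs ! Suc k} \<in> edges G)"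

definition walk_length :: "'a wgraph \<Rightarrow> 'a list \<Rightarrow> real" where
  "walk_length G xs = (\<Sum>k<length xs - 1. len G (xs ! k) (xs ! Suc k))"

(* The infimum of the empty set is \<infinity> in ennreal. *)
definition gdist :: "'a wgraph \<Rightarrow> 'a \<Rightarrow> 'a \<Rightarrow> ennreal" where
  "gdist G u v = (INF xs \<in> {xs. walk G xs \<and> hd xs = u \<and> last xs = v}. ennreal (walk_length G xs))"

(* The metric spaces of HOL-Analysis have real-valued distances, so the completion of the
   extended metric gdist is constructed here from Cauchy sequences of vertices. *)
definition cauchy_seqs :: "'a wgraph \<Rightarrow> (nat \<Rightarrow> 'a) set" where
  "cauchy_seqs G = {s. range s \<subseteq> verts G \<and>
     (\<forall>\<epsilon>>0. \<exists>N. \<forall>m\<ge>N. \<forall>n\<ge>N. gdist G (s m) (s n) < \<epsilon>)}"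

definition null_rel :: "'a wgraph \<Rightarrow> ((nat \<Rightarrow> 'a) \<times> (nat \<Rightarrow> 'a)) set" where
  "null_rel G = {(s, t). s \<in> cauchy_seqs G \<and> t \<in> cauchy_seqs G \<and>
     (\<lambda>n. gdist G (s n) (t n)) \<longlonglongrightarrow> 0}"

type_synonym 'a cpoint = "(nat \<Rightarrow> 'a) set"

definition graph_completion :: "'a wgraph \<Rightarrow> 'a cpoint set" where
  "graph_completion G = cauchy_seqs G // null_rel G"

definition vertex_point :: "'a wgraph \<Rightarrow> 'a \<Rightarrow> 'a cpoint" where
  "vertex_point G v = null_rel G `` {\<lambda>_. v}"

definition cdist :: "'a wgraph \<Rightarrow> 'a cpoint \<Rightarrow> 'a cpoint \<Rightarrow> ennreal" where
  "cdist G x y = (THE d. \<forall>s\<in>x. \<forall>t\<in>y. (\<lambda>n. gdist G (s n) (t n)) \<longlonglongrightarrow> d)"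

definition ctopology :: "'a wgraph \<Rightarrow> 'a cpoint topology" where
  "ctopology G = topology (\<lambda>U. U \<subseteq> graph_completion G \<and>
     (\<forall>x\<in>U. \<exists>\<epsilon>>0. \<forall>y\<in>graph_completion G. cdist G x y < \<epsilon> \<longrightarrow> y \<in> U))"

(* Rays are indexed from 0 instead of 1. *)
datatype 'a gpath = Finite_path "'a list" | Ray "nat \<Rightarrow> 'a" | Double_ray "int \<Rightarrow> 'a"

fun is_path :: "'a wgraph \<Rightarrow> 'a gpath \<Rightarrow> bool" where
  "is_path G (Finite_path xs) \<longleftrightarrow> walk G xs"
| "is_path G (Ray p) \<longleftrightarrow> range p \<subseteq> verts G \<and> (\<forall>k. {p k, p (Suc k)} \<in> edges G)"
| "is_path G (Double_ray p) \<longleftrightarrow> range p \<subseteq> verts G \<and> (\<forall>k. {p k, p (k + 1)} \<in> edges G)"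

fun path_edges :: "'a gpath \<Rightarrow> 'a set set" where
  "path_edges (Finite_path xs) = {{xs ! k, xs ! Suc k} | k. Suc k < length xs}"
| "path_edges (Ray p) = {{p k, p (Suc k)} | k. True}"
| "path_edges (Double_ray p) = {{p k, p (k + 1)} | k. True}"

(* A ray may be traversed in either direction, so it also serves as a path from a limit
   point to a vertex. *)
fun goes_from_to :: "'a wgraph \<Rightarrow> 'a gpath \<Rightarrow> 'a cpoint \<Rightarrow> 'a cpoint \<Rightarrow> bool" where
  "goes_from_to G (Finite_path xs) x y \<longleftrightarrow>
     vertex_point G (hd xs) = x \<and> vertex_point G (last xs) = y"
| "goes_from_to G (Ray p) x y \<longleftrightarrow>
     vertex_point G (p 0) = x \<and> limitin (ctopology G) (\<lambda>k. vertex_point G (p k)) y sequentially \<or>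
     limitin (ctopology G) (\<lambda>k. vertex_point G (p k)) x sequentially \<and> vertex_point G (p 0) = y"
| "goes_from_to G (Double_ray p) x y \<longleftrightarrow>
     limitin (ctopology G) (\<lambda>k. vertex_point G (p k)) x at_bot \<and>
     limitin (ctopology G) (\<lambda>k. vertex_point G (p k)) y at_top"

definition weakly_connected :: "'a wgraph \<Rightarrow> bool" where
  "weakly_connected G \<longleftrightarrow>
     (\<forall>x\<in>graph_completion G. \<forall>y\<in>graph_completion G. x \<noteq> y \<longrightarrow>
        (\<exists>W\<subseteq>edges G. finite W \<and>
           (\<forall>p. is_path G p \<and> goes_from_to G p x y \<longrightarrow> path_edges p \<inter> W \<noteq> {})))"

(* Only the values of \<phi> on verts G matter. *)
definition test_algebra :: "'a wgraph \<Rightarrow> ('a \<Rightarrow> real) set" where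
  "test_algebra G = {\<phi>. finite {e \<in> edges G. \<exists>u v. e = {u, v} \<and> \<phi> u \<noteq> \<phi> v}}"

(* extensional fixes the values outside the completion, so that the continuous extension is
   unique as a HOL function. *)
definition continuous_extension :: "'a wgraph \<Rightarrow> ('a \<Rightarrow> real) \<Rightarrow> 'a cpoint \<Rightarrow> real" where
  "continuous_extension G \<phi> = (THE g. g \<in> extensional (graph_completion G) \<and>
     continuous_map (ctopology G) euclideanreal g \<and>
     (\<forall>v\<in>verts G. g (vertex_point G v) = \<phi> v))"

definition separates_points :: "'a wgraph \<Rightarrow> bool" where
  "separates_points G \<longleftrightarrow>
     (\<forall>x\<in>graph_completion G. \<forall>y\<in>graph_completion G. x \<noteq> y \<longrightarrow>
        (\<exists>\<phi>\<in>test_algebra G. continuous_extension G \<phi> x \<noteq> continuous_extension G \<phi> y))"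


context weighted_graph
begin

lemma gdist_le: "walk G xs \<Longrightarrow> gdist G (hd xs) (last xs) \<le> ennreal (walk_length G xs)"
  unfolding gdist_def by (rule INF_lower) auto

lemma gdist_lessE:
  assumes "gdist G u v < c"
  obtains xs where "walk G xs" "hd xs = u" "last xs = v" "ennreal (walk_length G xs) < c"
  using assms unfolding gdist_def INF_less_iff by auto

lemma walk_length_nonneg: "walk G xs \<Longrightarrow> 0 \<le> walk_length G xs"
  unfolding walk_length_def walk_def
  by (intro sum_nonneg) (auto intro!: less_imp_le[OF len_pos])

lemma gdist_refl: "v \<in> verts G \<Longrightarrow> gdist G v v = 0"
  using gdist_le[of "[v]"] by (simp add: walk_def walk_length_def)

lemma walk_rev:
  assumes "walk G xs"
  shows "walk G (rev xs)" "walk_length G (rev xs) = walk_length G xs"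
proof -
  have e: "{xs ! k, xs ! Suc k} \<in> edges G" if "Suc k < length xs" for k
    using assms that by (auto simp: walk_def)
  have r: "rev xs ! k = xs ! Suc (length xs - Suc (Suc k))"
       "rev xs ! Suc k = xs ! (length xs - Suc (Suc k))" if "Suc k < length xs" for k
    using that by (auto simp: rev_nth Suc_diff_Suc)
  show "walk G (rev xs)"
    using assms e r unfolding walk_def by (auto simp: insert_commute)
  have "walk_length G (rev xs) =
      (\<Sum>k<length xs - 1. len G (xs ! (length xs - 1 - Suc k)) (xs ! Suc (length xs - 1 - Suc k)))"
    unfolding walk_length_def
  proof (rule sum.cong, simp, goal_cases)
    case (1 k)
    then have k: "Suc k < length xs" by auto
    have "len G (xs ! Suc (length xs - Suc (Suc k))) (xs ! (length xs - Suc (Suc k))) =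
          len G (xs ! (length xs - Suc (Suc k))) (xs ! Suc (length xs - Suc (Suc k)))"
      using e[of "length xs - Suc (Suc k)"] k by (intro len_sym) (auto simp: insert_commute)
    with r[OF k] show ?case by (simp add: numeral_2_eq_2)
  qed
  also have "\<dots> = walk_length G xs"
    unfolding walk_length_def
    by (rule sum.nat_diff_reindex[of "\<lambda>k. len G (xs ! k) (xs ! Suc k)"])
  finally show "walk_length G (rev xs) = walk_length G xs" .
qed

lemma gdist_commute: "gdist G u v = gdist G v u"
proof -
  have "gdist G u v \<le> gdist G v u" for u v
  proof (rule leI, rule notI)
    assume "gdist G v u < gdist G u v"
    then obtain xs where xs: "walk G xs" "hd xs = v" "last xs = u"
        "ennreal (walk_length G xs) < gdist G u v"
      by (rule gdist_lessE)
    with gdist_le[OF walk_rev(1)[OF xs(1)]] walk_rev(2)[OF xs(1)] show False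
      by (auto simp: hd_rev last_rev)
  qed
  then show ?thesis by (auto intro: antisym)
qed

lemma sum_lessThan_add:
  "(\<Sum>k<m + n. f k) = (\<Sum>k<m. f k) + (\<Sum>k<n. (f (m + k) :: real))" for m n :: nat
  by (induction n) simp_all

lemma walk_append:
  assumes xs: "walk G xs" and ys: "walk G ys" and eq: "last xs = hd ys"
  shows "walk G (xs @ tl ys)" "walk_length G (xs @ tl ys) = walk_length G xs + walk_length G ys"
    "hd (xs @ tl ys) = hd xs" "last (xs @ tl ys) = last ys"
proof -
  obtain y zs where y: "ys = y # zs" using ys by (cases ys) (auto simp: walk_def)
  have ne: "xs \<noteq> []" using xs by (auto simp: walk_def)
  then obtain ws where w: "xs = ws @ [y]" using eq y by (metis append_butlast_last_id list.sel(1))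
  have n1: "(ws @ y # zs) ! k = (ws @ [y]) ! k" if "k < Suc (length ws)" for k
    using that by (auto simp: nth_append less_Suc_eq)
  have n2: "(ws @ y # zs) ! (length ws + k) = (y # zs) ! k" for k
    by (simp add: nth_append)
  have E: "xs @ tl ys = ws @ y # zs" by (simp add: w y)
  show "walk G (xs @ tl ys)" unfolding E walk_def
  proof (intro conjI allI impI)
    show "set (ws @ y # zs) \<subseteq> verts G" using xs ys by (auto simp: walk_def w y)
    fix k assume k: "Suc k < length (ws @ y # zs)"
    show "{(ws @ y # zs) ! k, (ws @ y # zs) ! Suc k} \<in> edges G"
    proof (cases "k < length ws")
      case True
      then show ?thesis using xs n1[of k] n1[of "Suc k"] by (auto simp: walk_def w)
    next
      case False
      define j where "j = k - length ws"
      have "k = length ws + j" using False by (simp add: j_def)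
      then show ?thesis using ys n2[of j] n2[of "Suc j"] k by (auto simp: walk_def y)
    qed
  qed simp
  let ?f = "\<lambda>k. len G ((ws @ y # zs) ! k) ((ws @ y # zs) ! Suc k)"
  have "walk_length G (xs @ tl ys) = (\<Sum>k<length ws + length zs. ?f k)"
    unfolding E walk_length_def by simp
  also have "\<dots> = (\<Sum>k<length ws. ?f k) + (\<Sum>k<length zs. ?f (length ws + k))"
    by (rule sum_lessThan_add)
  also have "(\<Sum>k<length ws. ?f k) = walk_length G xs"
    unfolding walk_length_def w using n1 by (intro sum.cong) auto
  also have "(\<Sum>k<length zs. ?f (length ws + k)) = walk_length G ys"
    unfolding walk_length_def y using n2 by (intro sum.cong) (auto simp flip: add_Suc_right)
  finally show "walk_length G (xs @ tl ys) = walk_length G xs + walk_length G ys" .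
  show "hd (xs @ tl ys) = hd xs" using ne by simp
  show "last (xs @ tl ys) = last ys" by (simp add: w y)
qed

lemma ennreal_less_add_pos: "a < top \<Longrightarrow> 0 < e \<Longrightarrow> a < a + ennreal e"
  by (cases a) (auto simp: ennreal_less_iff simp flip: ennreal_plus)

lemma gdist_triangle: "gdist G u w \<le> gdist G u v + gdist G v w"
proof (rule ennreal_le_epsilon)
  fix e :: real
  assume fin: "gdist G u v + gdist G v w < top" and e: "0 < e"
  have "gdist G u v < gdist G u v + ennreal (e / 2)" "gdist G v w < gdist G v w + ennreal (e / 2)"
    using fin e by (auto intro!: ennreal_less_add_pos)
  then obtain xs ys where
    xs: "walk G xs" "hd xs = u" "last xs = v" "walk_length G xs < gdist G u v + ennreal (e / 2)" and
    ys: "walk G ys" "hd ys = v" "last ys = w" "walk_length G ys < gdist G v w + ennreal (e / 2)"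
    by (metis gdist_lessE)
  note a = walk_append[OF xs(1) ys(1)]
  have "gdist G u w \<le> ennreal (walk_length G xs + walk_length G ys)"
    using gdist_le[OF a(1)] a xs ys by simp
  also have "\<dots> = ennreal (walk_length G xs) + ennreal (walk_length G ys)"
    using walk_length_nonneg xs ys by simp
  also have "\<dots> \<le> (gdist G u v + ennreal (e / 2)) + (gdist G v w + ennreal (e / 2))"
    using xs ys by (intro add_mono) auto
  also have "\<dots> = gdist G u v + gdist G v w + (ennreal (e / 2) + ennreal (e / 2))"
    by (simp add: ac_simps)
  also have "ennreal (e / 2) + ennreal (e / 2) = ennreal e"
    using e by (subst ennreal_plus[symmetric]) auto
  finally show "gdist G u w \<le> gdist G u v + gdist G v w + ennreal e" .
qed

lemma cauchy_seqs_verts: "s \<in> cauchy_seqs G \<Longrightarrow> s n \<in> verts G"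
  by (auto simp: cauchy_seqs_def)

lemma const_cauchy: "v \<in> verts G \<Longrightarrow> (\<lambda>_. v) \<in> cauchy_seqs G"
  by (auto simp: cauchy_seqs_def gdist_refl)

lemma null_relI_bound:
  assumes "\<And>n. f n \<le> g n" "g \<longlonglongrightarrow> (0::ennreal)"
  shows "f \<longlonglongrightarrow> 0"
  by (rule tendsto_sandwich[OF _ _ tendsto_const assms(2)]) (use assms in auto)

lemma equiv_null_rel: "equiv (cauchy_seqs G) (null_rel G)"
proof (rule equivI)
  show "null_rel G \<subseteq> cauchy_seqs G \<times> cauchy_seqs G" by (auto simp: null_rel_def)
  show "refl_on (cauchy_seqs G) (null_rel G)"
    by (auto simp: refl_on_def null_rel_def gdist_refl cauchy_seqs_verts)
  show "sym (null_rel G)"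
    by (auto simp: sym_def null_rel_def gdist_commute)
  show "trans (null_rel G)"
  proof (rule transI)
    fix s t r assume "(s, t) \<in> null_rel G" "(t, r) \<in> null_rel G"
    then have "(\<lambda>n. gdist G (s n) (t n) + gdist G (t n) (r n)) \<longlonglongrightarrow> 0 + 0"
      by (intro tendsto_add) (auto simp: null_rel_def)
    then have "(\<lambda>n. gdist G (s n) (r n)) \<longlonglongrightarrow> 0"
      by (intro null_relI_bound[OF gdist_triangle]) simp
    then show "(s, r) \<in> null_rel G"
      using \<open>(s, t) \<in> null_rel G\<close> \<open>(t, r) \<in> null_rel G\<close> by (auto simp: null_rel_def)
  qed
qed

lemma vertex_point_in: "v \<in> verts G \<Longrightarrow> vertex_point G v \<in> graph_completion G"
  unfolding graph_completion_def vertex_point_def by (intro quotientI const_cauchy)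

lemma const_in_vertex_point: "v \<in> verts G \<Longrightarrow> (\<lambda>_. v) \<in> vertex_point G v"
  unfolding vertex_point_def using equiv_class_self[OF equiv_null_rel] const_cauchy by auto

lemma graph_completion_cauchy: "x \<in> graph_completion G \<Longrightarrow> s \<in> x \<Longrightarrow> s \<in> cauchy_seqs G"
  unfolding graph_completion_def using equiv_null_rel in_quotient_imp_subset by blast

lemma graph_completion_rel:
  "x \<in> graph_completion G \<Longrightarrow> s \<in> x \<Longrightarrow> t \<in> x \<Longrightarrow> (s, t) \<in> null_rel G"
  unfolding graph_completion_def using equiv_null_rel quotient_eq_iff by fastforce

lemma graph_completion_nonempty: "x \<in> graph_completion G \<Longrightarrow> \<exists>s. s \<in> x"
  unfolding graph_completion_def using equiv_null_rel in_quotient_imp_non_empty by blast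

lemma gdist_tendsto_exists:
  assumes s: "s \<in> cauchy_seqs G" and t: "t \<in> cauchy_seqs G"
  shows "\<exists>d. (\<lambda>n. gdist G (s n) (t n)) \<longlonglongrightarrow> d"
proof -
  let ?a = "\<lambda>n. gdist G (s n) (t n)"
  have "limsup ?a \<le> liminf ?a"
  proof (rule ennreal_le_epsilon)
    fix e :: real assume e: "0 < e"
    then have "0 < ennreal (e / 2)" by simp
    with s t have
      ex: "\<exists>N. \<forall>m\<ge>N. \<forall>n\<ge>N. gdist G (s m) (s n) < ennreal (e / 2)"
      "\<exists>N. \<forall>m\<ge>N. \<forall>n\<ge>N. gdist G (t m) (t n) < ennreal (e / 2)"
      unfolding cauchy_seqs_def by simp_all
    from ex(1) obtain N where
      N: "\<And>m n. m \<ge> N \<Longrightarrow> n \<ge> N \<Longrightarrow> gdist G (s m) (s n) < ennreal (e / 2)" by auto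
    from ex(2) obtain M where
      M: "\<And>m n. m \<ge> M \<Longrightarrow> n \<ge> M \<Longrightarrow> gdist G (t m) (t n) < ennreal (e / 2)"
      by auto
    have le: "?a m \<le> ?a n + ennreal e" if "m \<ge> max N M" "n \<ge> max N M" for m n
    proof -
      have "?a m \<le> gdist G (s m) (s n) + (?a n + gdist G (t n) (t m))"
        by (rule order_trans[OF gdist_triangle[of "s m" "t m" "s n"]
              add_left_mono[OF gdist_triangle[of "s n" "t m" "t n"]]])
      also have "\<dots> \<le> ennreal (e / 2) + (?a n + ennreal (e / 2))"
        using N[of m n] M[of n m] that by (intro add_mono) auto
      also have "\<dots> = ?a n + (ennreal (e / 2) + ennreal (e / 2))"
        by (simp add: ac_simps)
      also have "ennreal (e / 2) + ennreal (e / 2) = ennreal e"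
        using e by (subst ennreal_plus[symmetric]) auto
      finally show ?thesis .
    qed
    have "limsup ?a \<le> ?a n + ennreal e" if "n \<ge> max N M" for n
      by (intro Limsup_bounded eventually_sequentiallyI[of "max N M"] le that)
    then have "limsup ?a - ennreal e \<le> ?a n" if "n \<ge> max N M" for n
      using that by (simp add: ennreal_minus_le_iff add.commute)
    then have "limsup ?a - ennreal e \<le> liminf ?a"
      by (intro Liminf_bounded eventually_sequentiallyI[of "max N M"])
    then show "limsup ?a \<le> liminf ?a + ennreal e"
      by (simp add: ennreal_minus_le_iff add.commute)
  qed
  then have "liminf ?a = limsup ?a"
    using Liminf_le_Limsup[of sequentially ?a] by (auto intro: antisym)
  then have "?a \<longlonglongrightarrow> limsup ?a"
    using Liminf_eq_Limsup[of sequentially ?a] by simp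
  then show ?thesis by blast
qed

lemma gdist_tendsto_le:
  assumes "(s, s') \<in> null_rel G" "(t, t') \<in> null_rel G"
    "(\<lambda>n. gdist G (s n) (t n)) \<longlonglongrightarrow> a" "(\<lambda>n. gdist G (s' n) (t' n)) \<longlonglongrightarrow> b"
  shows "b \<le> a"
proof -
  have "(\<lambda>n. gdist G (s n) (s' n) + (gdist G (s n) (t n) + gdist G (t n) (t' n))) \<longlonglongrightarrow> 0 + (a + 0)"
    using assms by (intro tendsto_add) (auto simp: null_rel_def)
  then have lim: "(\<lambda>n. gdist G (s n) (s' n) + (gdist G (s n) (t n) + gdist G (t n) (t' n))) \<longlonglongrightarrow> a"
    by simp
  have "gdist G (s' n) (t' n) \<le> gdist G (s n) (s' n) + (gdist G (s n) (t n) + gdist G (t n) (t' n))" for n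
    using order_trans[OF gdist_triangle[of "s' n" "t' n" "s n"]
        add_left_mono[OF gdist_triangle[of "s n" "t' n" "t n"]]]
    by (simp only: gdist_commute[of "s' n" "s n"])
  then show ?thesis
    using LIMSEQ_le[OF assms(4) lim] by blast
qed

lemma cdist_tendsto:
  assumes x: "x \<in> graph_completion G" "s \<in> x" and y: "y \<in> graph_completion G" "t \<in> y"
  shows "(\<lambda>n. gdist G (s n) (t n)) \<longlonglongrightarrow> cdist G x y"
proof -
  obtain d where d: "(\<lambda>n. gdist G (s n) (t n)) \<longlonglongrightarrow> d"
    using gdist_tendsto_exists[OF graph_completion_cauchy[OF x] graph_completion_cauchy[OF y]] by auto
  have all: "(\<lambda>n. gdist G (s' n) (t' n)) \<longlonglongrightarrow> d" if st': "s' \<in> x" "t' \<in> y" for s' t'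
  proof -
    obtain d' where d': "(\<lambda>n. gdist G (s' n) (t' n)) \<longlonglongrightarrow> d'"
      using gdist_tendsto_exists[OF graph_completion_cauchy[OF x(1) st'(1)]
          graph_completion_cauchy[OF y(1) st'(2)]] by auto
    have "d' = d"
    proof (rule antisym)
      show "d' \<le> d"
        by (rule gdist_tendsto_le[OF _ _ d d']) (use graph_completion_rel x y that in auto)
      show "d \<le> d'"
        by (rule gdist_tendsto_le[OF _ _ d' d]) (use graph_completion_rel x y that in auto)
    qed
    with d' show ?thesis by simp
  qed
  have "cdist G x y = d"
    unfolding cdist_def
  proof (rule the_equality)
    fix e assume "\<forall>s\<in>x. \<forall>t\<in>y. (\<lambda>n. gdist G (s n) (t n)) \<longlonglongrightarrow> e"
    then have "(\<lambda>n. gdist G (s n) (t n)) \<longlonglongrightarrow> e" using x(2) y(2) by blast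
    then show "e = d" using d by (rule LIMSEQ_unique)
  qed (use all in simp)
  with d show ?thesis by simp
qed

lemma openin_ctopology:
  "openin (ctopology G) U \<longleftrightarrow> U \<subseteq> graph_completion G \<and>
     (\<forall>x\<in>U. \<exists>\<epsilon>>0. \<forall>y\<in>graph_completion G. cdist G x y < \<epsilon> \<longrightarrow> y \<in> U)"
proof -
  let ?L = "\<lambda>U. U \<subseteq> graph_completion G \<and>
     (\<forall>x\<in>U. \<exists>\<epsilon>>0. \<forall>y\<in>graph_completion G. cdist G x y < \<epsilon> \<longrightarrow> y \<in> U)"
  have inter: "?L (S \<inter> T)" if S: "?L S" and T: "?L T" for S T
  proof (intro conjI ballI)
    show "S \<inter> T \<subseteq> graph_completion G" using S by auto
    fix x assume x: "x \<in> S \<inter> T"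
    from S x obtain a where "a > 0" "\<forall>y\<in>graph_completion G. cdist G x y < a \<longrightarrow> y \<in> S" by auto
    moreover from T x obtain b where "b > 0" "\<forall>y\<in>graph_completion G. cdist G x y < b \<longrightarrow> y \<in> T"
      by auto
    ultimately show "\<exists>\<epsilon>>0. \<forall>y\<in>graph_completion G. cdist G x y < \<epsilon> \<longrightarrow> y \<in> S \<inter> T"
      by (intro exI[of _ "min a b"]) auto
  qed
  have union: "?L (\<Union>K)" if K: "\<forall>S\<in>K. ?L S" for K
  proof (intro conjI ballI)
    show "\<Union>K \<subseteq> graph_completion G" using K by auto
    fix x assume "x \<in> \<Union>K"
    then obtain S where S: "S \<in> K" "x \<in> S" by auto
    with K have "\<exists>\<epsilon>>0. \<forall>y\<in>graph_completion G. cdist G x y < \<epsilon> \<longrightarrow> y \<in> S" by simp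
    then show "\<exists>\<epsilon>>0. \<forall>y\<in>graph_completion G. cdist G x y < \<epsilon> \<longrightarrow> y \<in> \<Union>K"
      using S by (meson UnionI)
  qed
  have "istopology ?L"
    unfolding istopology_def
    by (rule conjI; intro allI impI; (rule inter; assumption | rule union; assumption))
  then show ?thesis by (simp add: ctopology_def)
qed

lemma cdist_refl: "x \<in> graph_completion G \<Longrightarrow> cdist G x x = 0"
proof -
  assume x: "x \<in> graph_completion G"
  then obtain s where s: "s \<in> x" using graph_completion_nonempty by blast
  show ?thesis
    by (rule LIMSEQ_unique[OF cdist_tendsto[OF x s x s]])
      (use graph_completion_rel[OF x s s] in \<open>simp add: null_rel_def\<close>)
qed

lemma topspace_ctopology: "topspace (ctopology G) = graph_completion G"
proof -
  have "openin (ctopology G) (graph_completion G)"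
    unfolding openin_ctopology by (intro conjI ballI exI[of _ 1]) simp_all
  then have "graph_completion G \<subseteq> topspace (ctopology G)" by (rule openin_subset)
  moreover have "topspace (ctopology G) \<subseteq> graph_completion G"
    using openin_topspace[of "ctopology G"] unfolding openin_ctopology by (rule conjunct1)
  ultimately show ?thesis by (rule antisym[rotated])
qed

lemma vertex_point_limit:
  assumes "x \<in> graph_completion G" "s \<in> x"
  shows "limitin (ctopology G) (\<lambda>n. vertex_point G (s n)) x sequentially"
  unfolding limitin_def topspace_ctopology
proof (intro conjI allI impI assms(1))
  fix U assume U: "openin (ctopology G) U \<and> x \<in> U"
  then obtain e where e: "e > 0" "\<And>y. y \<in> graph_completion G \<Longrightarrow> cdist G x y < e \<Longrightarrow> y \<in> U"
    unfolding openin_ctopology by blast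
  obtain e' where e': "0 < e'" "e' < e" using dense[OF e(1)] by auto
  have s: "s \<in> cauchy_seqs G" using assms graph_completion_cauchy by blast
  then have "\<exists>N. \<forall>m\<ge>N. \<forall>n\<ge>N. gdist G (s m) (s n) < e'"
    unfolding cauchy_seqs_def using e'(1) by simp
  then obtain N where N: "\<And>m n. m \<ge> N \<Longrightarrow> n \<ge> N \<Longrightarrow> gdist G (s m) (s n) < e'" by auto
  have "vertex_point G (s n) \<in> U" if "n \<ge> N" for n
  proof (rule e(2))
    show v: "vertex_point G (s n) \<in> graph_completion G"
      by (intro vertex_point_in cauchy_seqs_verts s)
    have "(\<lambda>m. gdist G (s m) (s n)) \<longlonglongrightarrow> cdist G x (vertex_point G (s n))"
      by (intro cdist_tendsto[OF assms v] const_in_vertex_point cauchy_seqs_verts s)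
    then have "cdist G x (vertex_point G (s n)) \<le> e'"
      by (rule LIMSEQ_le_const2) (use that in \<open>blast intro: less_imp_le N\<close>)
    then show "cdist G x (vertex_point G (s n)) < e" using e' by simp
  qed
  then show "\<forall>\<^sub>F n in sequentially. vertex_point G (s n) \<in> U"
    by (intro eventually_sequentiallyI[of N])
qed

lemma finite_edges_len_bound:
  assumes "finite W" "W \<subseteq> edges G"
  shows "\<exists>\<delta>>0. \<forall>u v. {u, v} \<in> W \<longrightarrow> \<delta> \<le> len G u v"
  using assms
proof (induction W)
  case empty
  then show ?case by (intro exI[of _ 1]) auto
next
  case (insert e W)
  then obtain d where d: "d > 0" "\<And>u v. {u, v} \<in> W \<Longrightarrow> d \<le> len G u v" by auto
  obtain a b where ab: "e = {a, b}" "{a, b} \<in> edges G"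
    using simple_edges[of e] insert by auto
  have "min d (len G a b) \<le> len G u v" if "{u, v} \<in> insert e W" for u v
  proof (cases "{u, v} \<in> W")
    case True
    then show ?thesis using d(2)[of u v] by simp
  next
    case False
    with that ab have "u = a \<and> v = b \<or> u = b \<and> v = a" by (simp add: doubleton_eq_iff)
    then show ?thesis using len_sym[OF ab(2)] by auto
  qed
  moreover have "0 < min d (len G a b)" using d(1) len_pos[OF ab(2)] by simp
  ultimately show ?case by blast
qed

lemma test_algebra_locally_constant:
  assumes "\<phi> \<in> test_algebra G"
  shows "\<exists>\<delta>>0. \<forall>u v. gdist G u v < \<delta> \<longrightarrow> \<phi> u = \<phi> v"
proof -
  define W where "W = {e \<in> edges G. \<exists>u v. e = {u, v} \<and> \<phi> u \<noteq> \<phi> v}"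
  have "finite W" "W \<subseteq> edges G" using assms by (auto simp: W_def test_algebra_def)
  then obtain d where d: "d > 0" "\<And>u v. {u, v} \<in> W \<Longrightarrow> d \<le> len G u v"
    using finite_edges_len_bound[of W] by auto
  have "\<phi> u = \<phi> v" if lt: "gdist G u v < ennreal d" for u v
  proof -
    obtain xs where xs: "walk G xs" "hd xs = u" "last xs = v" "ennreal (walk_length G xs) < ennreal d"
      using lt by (rule gdist_lessE)
    then have l: "walk_length G xs < d"
      using walk_length_nonneg ennreal_less_iff by blast
    have "\<phi> (xs ! k) = \<phi> (xs ! 0)" if "k < length xs" for k
      using that
    proof (induction k)
      case (Suc k)
      have e: "{xs ! k, xs ! Suc k} \<in> edges G" using Suc xs by (auto simp: walk_def)
      have "len G (xs ! k) (xs ! Suc k) \<le> walk_length G xs"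
        unfolding walk_length_def
        by (rule member_le_sum[of k _ "\<lambda>k. len G (xs ! k) (xs ! Suc k)"])
          (use Suc xs in \<open>auto intro!: less_imp_le[OF len_pos] simp: walk_def\<close>)
      with l have "{xs ! k, xs ! Suc k} \<notin> W" using d(2)[of "xs ! k" "xs ! Suc k"] by linarith
      with e have "\<phi> (xs ! k) = \<phi> (xs ! Suc k)" unfolding W_def by blast
      then show ?case using Suc by simp
    qed simp
    note const = this
    have ne: "xs \<noteq> []" using xs(1) by (simp add: walk_def)
    then show ?thesis
      using const[of "length xs - 1"] xs(2,3) by (simp add: hd_conv_nth last_conv_nth)
  qed
  then show ?thesis using d(1) by (intro exI[of _ "ennreal d"]) simp
qed

lemma continuous_extension_ex1:
  assumes "\<phi> \<in> test_algebra G"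
  shows "\<exists>!g. g \<in> extensional (graph_completion G) \<and>
     continuous_map (ctopology G) euclideanreal g \<and>
     (\<forall>v\<in>verts G. g (vertex_point G v) = \<phi> v)"
proof -
  obtain \<delta> where \<delta>: "\<delta> > 0" "\<And>u v. gdist G u v < \<delta> \<Longrightarrow> \<phi> u = \<phi> v"
    using test_algebra_locally_constant[OF assms] by auto
  define g where "g = restrict (\<lambda>x. lim (\<lambda>n. \<phi> ((SOME s. s \<in> x) n))) (graph_completion G)"
  have conv: "convergent (\<lambda>n. \<phi> (s n))" if s: "s \<in> cauchy_seqs G" for s
  proof -
    have "\<exists>N. \<forall>m\<ge>N. \<forall>n\<ge>N. gdist G (s m) (s n) < \<delta>"
      using s \<delta>(1) unfolding cauchy_seqs_def by simp
    then obtain N where N: "\<And>m n. m \<ge> N \<Longrightarrow> n \<ge> N \<Longrightarrow> gdist G (s m) (s n) < \<delta>" by auto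
    have "\<phi> (s n) = \<phi> (s N)" if "n \<ge> N" for n
      by (rule \<delta>(2)[OF N[OF that order_refl]])
    then have "\<forall>\<^sub>F n in sequentially. \<phi> (s n) = \<phi> (s N)"
      unfolding eventually_sequentially by blast
    then show ?thesis by (intro convergentI[of _ "\<phi> (s N)"] tendsto_eventually)
  qed
  have ev: "\<forall>\<^sub>F n in sequentially. \<phi> (s n) = \<phi> (t n)"
    if xy: "x \<in> graph_completion G" "y \<in> graph_completion G" and st: "s \<in> x" "t \<in> y"
      and lt: "cdist G x y < \<delta>" for x y s t
    using order_tendstoD(2)[OF cdist_tendsto[OF xy(1) st(1) xy(2) st(2)] lt]
    by (rule eventually_mono) (rule \<delta>(2))
  have g: "(\<lambda>n. \<phi> (s n)) \<longlonglongrightarrow> g x" if x: "x \<in> graph_completion G" and s: "s \<in> x" for x s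
  proof -
    define t where "t = (SOME s. s \<in> x)"
    have t: "t \<in> x" unfolding t_def using s by (rule someI[of "\<lambda>s. s \<in> x"])
    have "(\<lambda>n. \<phi> (t n)) \<longlonglongrightarrow> g x"
      using conv[OF graph_completion_cauchy[OF x t]] x
      by (simp add: g_def convergent_LIMSEQ_iff flip: t_def)
    moreover have "\<forall>\<^sub>F n in sequentially. \<phi> (t n) = \<phi> (s n)"
      by (rule ev[OF x x t s]) (simp add: cdist_refl x \<delta>(1))
    ultimately show ?thesis by (rule Lim_transform_eventually)
  qed
  have loc: "g x = g y"
    if xy: "x \<in> graph_completion G" "y \<in> graph_completion G" and lt: "cdist G x y < \<delta>" for x y
  proof -
    obtain s t where st: "s \<in> x" "t \<in> y"
      using graph_completion_nonempty[OF xy(1)] graph_completion_nonempty[OF xy(2)] by auto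
    have "(\<lambda>n. \<phi> (t n)) \<longlonglongrightarrow> g x"
      by (rule Lim_transform_eventually[OF g[OF xy(1) st(1)] ev[OF xy st lt]])
    then show ?thesis using g[OF xy(2) st(2)] by (rule LIMSEQ_unique)
  qed
  show ?thesis
  proof (rule ex1I[of _ g], intro conjI ballI)
    show "g \<in> extensional (graph_completion G)" by (simp add: g_def)
    show "continuous_map (ctopology G) euclideanreal g"
      unfolding continuous_map_def topspace_ctopology
    proof (intro conjI allI impI)
      fix U
      show "openin (ctopology G) {x \<in> graph_completion G. g x \<in> U}"
        unfolding openin_ctopology
      proof (intro conjI ballI)
        fix x assume x: "x \<in> {x \<in> graph_completion G. g x \<in> U}"
        show "\<exists>\<epsilon>>0. \<forall>y\<in>graph_completion G. cdist G x y < \<epsilon> \<longrightarrow> y \<in> {x \<in> graph_completion G. g x \<in> U}"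
        proof (intro exI[of _ \<delta>] conjI ballI impI \<delta>(1))
          fix y assume y: "y \<in> graph_completion G" "cdist G x y < \<delta>"
          with loc[of x y] x show "y \<in> {x \<in> graph_completion G. g x \<in> U}" by simp
        qed
      qed auto
    qed simp
    fix v assume v: "v \<in> verts G"
    have "(\<lambda>n. \<phi> v) \<longlonglongrightarrow> g (vertex_point G v)"
      by (rule g[OF vertex_point_in[OF v] const_in_vertex_point[OF v]])
    then show "g (vertex_point G v) = \<phi> v" by (simp add: LIMSEQ_const_iff)
  next
    fix h assume h: "h \<in> extensional (graph_completion G) \<and>
      continuous_map (ctopology G) euclideanreal h \<and> (\<forall>v\<in>verts G. h (vertex_point G v) = \<phi> v)"
    show "h = g"
    proof (rule extensionalityI[of _ "graph_completion G"])
      fix x assume x: "x \<in> graph_completion G"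
      then obtain s where s: "s \<in> x" using graph_completion_nonempty[OF x] by auto
      have "limitin euclideanreal (h \<circ> (\<lambda>n. vertex_point G (s n))) (h x) sequentially"
        using h vertex_point_limit[OF x s] by (intro continuous_map_limit) auto
      moreover have "h \<circ> (\<lambda>n. vertex_point G (s n)) = (\<lambda>n. \<phi> (s n))"
        using h cauchy_seqs_verts[OF graph_completion_cauchy[OF x s]] by (auto simp: fun_eq_iff)
      ultimately show "h x = g x" using g[OF x s] by (auto intro: LIMSEQ_unique)
    qed (use h in \<open>auto simp: g_def\<close>)
  qed
qed

end

end

theory Submission
  imports Defs
begin

text \<open>For (i), let the finite set \<open>W\<close> of edges meet every path from \<open>x\<close> to \<open>y\<close> and let \<open>\<delta>\<close> bound
the lengths of the edges in \<open>W\<close> from below. Walks shorter than \<open>\<delta>\<close> avoid \<open>W\<close>, so all vertices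
closer than \<open>\<delta>\<close> to \<open>x\<close> lie in one component of the graph without \<open>W\<close>, and \<open>\<phi>\<close> is the indicator
function of the complement of this component. If a vertex closer than \<open>\<delta>\<close> to \<open>y\<close> were in the
component as well, concatenating short walks at both ends would give a path from \<open>x\<close> to \<open>y\<close> that
avoids \<open>W\<close>. For (ii), if \<open>\<phi>\<close> separates \<open>x\<close> from \<open>y\<close>, then the edges on which \<open>\<phi>\<close> is not
constant form the required set: along a path that avoids them \<open>\<phi>\<close> is constant, hence equal at the
two ends.\<close>

context weighted_graph
begin

section \<open>Connectedness after deleting a set of edges\<close>

text \<open>Stated with \<open>successively\<close> instead of indices so that the library rules for
  \<open>@\<close> and \<open>rev\<close> apply; \<open>avoiding_walk_iff\<close> translates to
  \<open>walk\<close> and \<open>path_edges\<close>.\<close>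

definition avoiding_walk :: "'a set set \<Rightarrow> 'a list \<Rightarrow> bool" where
  "avoiding_walk W xs \<longleftrightarrow>
     xs \<noteq> [] \<and> set xs \<subseteq> verts G \<and> successively (\<lambda>u v. {u, v} \<in> edges G - W) xs"

text \<open>On \<open>verts G\<close> this is an equivalence relation; its classes are the
  components that remain once \<open>W\<close> is deleted.\<close>

definition linked :: "'a set set \<Rightarrow> 'a \<Rightarrow> 'a \<Rightarrow> bool" where
  "linked W u v \<longleftrightarrow> (\<exists>xs. avoiding_walk W xs \<and> hd xs = u \<and> last xs = v)"

lemma avoiding_walk_iff:
  "avoiding_walk W xs \<longleftrightarrow> walk G xs \<and> path_edges (Finite_path xs) \<inter> W = {}"
  unfolding avoiding_walk_def walk_def successively_conv_nth by auto

lemma avoiding_walk_append: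
  assumes "avoiding_walk W xs" "avoiding_walk W ys" "last xs = hd ys"
  shows "avoiding_walk W (xs @ tl ys)"
  using assms unfolding avoiding_walk_def
  by (cases ys) (auto simp: successively_append_iff successively_Cons)

lemma last_append_tl: "xs \<noteq> [] \<Longrightarrow> ys \<noteq> [] \<Longrightarrow> last xs = hd ys \<Longrightarrow> last (xs @ tl ys) = last ys"
  by (cases ys) auto

lemma linked_refl: "v \<in> verts G \<Longrightarrow> linked W v v"
  unfolding linked_def by (rule exI[of _ "[v]"]) (simp add: avoiding_walk_def)

lemma linked_sym:
  assumes "linked W u v"
  shows "linked W v u"
proof -
  obtain xs where xs: "avoiding_walk W xs" "hd xs = u" "last xs = v"
    using assms unfolding linked_def by auto
  then have "avoiding_walk W (rev xs)"
    by (simp add: avoiding_walk_def insert_commute)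
  then show ?thesis
    unfolding linked_def using xs by (intro exI[of _ "rev xs"]) (simp add: hd_rev last_rev)
qed

lemma linked_trans:
  assumes "linked W u v" "linked W v w"
  shows "linked W u w"
proof -
  obtain xs ys where xs: "avoiding_walk W xs" "hd xs = u" "last xs = v"
    and ys: "avoiding_walk W ys" "hd ys = v" "last ys = w"
    using assms unfolding linked_def by auto
  have "xs \<noteq> []" "ys \<noteq> []" using xs ys by (auto simp: avoiding_walk_def)
  then show ?thesis
    unfolding linked_def using xs ys avoiding_walk_append[of W xs ys] last_append_tl[of xs ys]
    by (intro exI[of _ "xs @ tl ys"]) auto
qed

lemma linked_edge:
  assumes "{u, v} \<in> edges G" "{u, v} \<notin> W"
  shows "linked W u v"
proof -
  have "u \<in> verts G" "v \<in> verts G"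
    using simple_edges[OF assms(1)] by (auto simp: doubleton_eq_iff)
  then show ?thesis
    unfolding linked_def using assms
    by (intro exI[of _ "[u, v]"]) (auto simp: avoiding_walk_def)
qed

lemma linked_verts: "linked W u v \<Longrightarrow> u \<in> verts G \<and> v \<in> verts G"
  unfolding linked_def avoiding_walk_def by (metis hd_in_set last_in_set subsetD)

section \<open>Short walks\<close>

lemma walk_take:
  assumes "walk G xs" "k < length xs"
  shows "walk G (take (Suc k) xs)" "walk_length G (take (Suc k) xs) \<le> walk_length G xs"
    "hd (take (Suc k) xs) = hd xs" "last (take (Suc k) xs) = xs ! k"
proof -
  show "walk G (take (Suc k) xs)"
    using assms by (auto simp: walk_def dest: in_set_takeD)
  show "hd (take (Suc k) xs) = hd xs" by simp
  show "last (take (Suc k) xs) = xs ! k"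
    using assms by (simp add: take_Suc_conv_app_nth)
  have "walk_length G (take (Suc k) xs) = (\<Sum>i<k. len G (xs ! i) (xs ! Suc i))"
    unfolding walk_length_def using assms(2) by (intro sum.cong) auto
  also have "\<dots> \<le> walk_length G xs"
    unfolding walk_length_def
    by (rule sum_mono2) (use assms in \<open>auto simp: walk_def intro!: less_imp_le[OF len_pos]\<close>)
  finally show "walk_length G (take (Suc k) xs) \<le> walk_length G xs" .
qed

text \<open>A walk through an edge of \<open>W\<close> has length at least \<open>\<delta>\<close>,
  and an initial segment is never longer than the whole walk. The separate bound \<open>c\<close>
  may shrink while \<open>\<delta>\<close> stays fixed; the clause on \<open>z\<close> later forces
  the concatenated walks to converge.\<close>

lemma short_walk_avoids:
  assumes \<delta>: "\<forall>u v. {u, v} \<in> W \<longrightarrow> \<delta> \<le> len G u v"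
    and "c \<le> \<delta>" "gdist G u v < ennreal c"
  shows "\<exists>xs. avoiding_walk W xs \<and> hd xs = u \<and> last xs = v \<and> (\<forall>z\<in>set xs. gdist G u z < ennreal c)"
proof -
  obtain xs where xs: "walk G xs" "hd xs = u" "last xs = v" "ennreal (walk_length G xs) < ennreal c"
    using assms(3) by (rule gdist_lessE)
  then have l: "walk_length G xs < c"
    using walk_length_nonneg ennreal_less_iff by blast
  have "{xs ! k, xs ! Suc k} \<notin> W" if "Suc k < length xs" for k
  proof
    assume "{xs ! k, xs ! Suc k} \<in> W"
    then have "\<delta> \<le> len G (xs ! k) (xs ! Suc k)" using \<delta> by blast
    also have "\<dots> \<le> walk_length G xs"
      unfolding walk_length_def
      by (rule member_le_sum[of k _ "\<lambda>k. len G (xs ! k) (xs ! Suc k)"])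
        (use that xs(1) in \<open>auto intro!: less_imp_le[OF len_pos] simp: walk_def\<close>)
    finally show False using l assms(2) by simp
  qed
  then have "avoiding_walk W xs" using xs(1) by (auto simp: avoiding_walk_iff)
  moreover have "gdist G u z < ennreal c" if z: "z \<in> set xs" for z
  proof -
    obtain k where k: "k < length xs" "z = xs ! k" using z by (auto simp: in_set_conv_nth)
    have "gdist G u z \<le> ennreal (walk_length G (take (Suc k) xs))"
      using gdist_le[OF walk_take(1)[OF xs(1) k(1)]] walk_take[OF xs(1) k(1)] xs(2) k(2) by simp
    also have "\<dots> \<le> ennreal (walk_length G xs)"
      by (intro ennreal_leI walk_take[OF xs(1) k(1)])
    finally show ?thesis using xs(4) by simp
  qed
  ultimately show ?thesis using xs by blast
qed

lemma linked_if_close: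
  assumes "\<forall>u v. {u, v} \<in> W \<longrightarrow> \<delta> \<le> len G u v" "gdist G u v < ennreal \<delta>"
  shows "linked W u v"
  using short_walk_avoids[OF assms(1) order_refl assms(2)] unfolding linked_def by blast

section \<open>Distances between points of the completion and vertices\<close>

abbreviation vdist :: "'a cpoint \<Rightarrow> 'a \<Rightarrow> ennreal" where
  "vdist x v \<equiv> cdist G x (vertex_point G v)"

lemma vdist_tendsto:
  assumes "x \<in> graph_completion G" "s \<in> x" "v \<in> verts G"
  shows "(\<lambda>n. gdist G (s n) v) \<longlonglongrightarrow> vdist x v"
  using cdist_tendsto[OF assms(1,2) vertex_point_in const_in_vertex_point] assms(3) by simp

lemma vdist_vertex_point:
  assumes "u \<in> verts G" "v \<in> verts G"
  shows "vdist (vertex_point G u) v = gdist G u v"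
  using vdist_tendsto[OF vertex_point_in const_in_vertex_point assms(2), OF assms(1) assms(1)]
  by (simp add: LIMSEQ_const_iff)

lemma vdist_triangle:
  assumes x: "x \<in> graph_completion G" and "u \<in> verts G" "v \<in> verts G"
  shows "vdist x v \<le> vdist x u + gdist G u v"
proof -
  obtain s where s: "s \<in> x" using graph_completion_nonempty[OF x] by auto
  show ?thesis
    by (rule LIMSEQ_le[OF vdist_tendsto[OF x s assms(3)]
          tendsto_add[OF vdist_tendsto[OF x s assms(2)] tendsto_const]])
      (use gdist_triangle in blast)
qed

lemma eventually_vdist_less:
  assumes x: "x \<in> graph_completion G" and s: "s \<in> x" and "0 < e"
  shows "\<forall>\<^sub>F n in sequentially. vdist x (s n) < e"
proof -
  \<comment> \<open>Passing to the limit weakens the strict Cauchy bound to a non-strict one, so a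
    bound smaller than \<open>e\<close> is used.\<close>
  obtain e' where e': "0 < e'" "e' < e" using dense[OF assms(3)] by auto
  have c: "s \<in> cauchy_seqs G" using x s graph_completion_cauchy by blast
  then have "\<exists>N. \<forall>m\<ge>N. \<forall>n\<ge>N. gdist G (s m) (s n) < e'"
    unfolding cauchy_seqs_def using e'(1) by simp
  then obtain N where N: "\<And>m n. m \<ge> N \<Longrightarrow> n \<ge> N \<Longrightarrow> gdist G (s m) (s n) < e'" by auto
  have "vdist x (s n) < e" if "n \<ge> N" for n
  proof -
    have "vdist x (s n) \<le> e'"
      by (rule LIMSEQ_le_const2[OF vdist_tendsto[OF x s cauchy_seqs_verts[OF c]]])
        (use that in \<open>blast intro: less_imp_le N\<close>)
    then show ?thesis using e' by simp
  qed
  then show ?thesis by (intro eventually_sequentiallyI[of N])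
qed

lemma limitin_vdist:
  assumes "x \<in> graph_completion G" "\<And>k. p k \<in> verts G"
    and "\<And>e. 0 < e \<Longrightarrow> \<forall>\<^sub>F k in F. vdist x (p k) < e"
  shows "limitin (ctopology G) (\<lambda>k. vertex_point G (p k)) x F"
  unfolding limitin_def topspace_ctopology
proof (intro conjI allI impI assms(1))
  fix U assume U: "openin (ctopology G) U \<and> x \<in> U"
  then obtain e where e: "e > 0" "\<And>y. y \<in> graph_completion G \<Longrightarrow> cdist G x y < e \<Longrightarrow> y \<in> U"
    unfolding openin_ctopology by blast
  show "\<forall>\<^sub>F k in F. vertex_point G (p k) \<in> U"
    using assms(3)[OF e(1)] by eventually_elim (intro e(2) vertex_point_in assms(2))
qed

section \<open>Rays converging to a point of the completion\<close>

text \<open>A representative that is eventually \<open>v\<close> is equivalent to the constant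
  sequence \<open>v\<close>, which would make \<open>x\<close> the point of that vertex.\<close>

lemma frequently_neq_vertex:
  assumes x: "x \<in> graph_completion G" and s: "s \<in> x"
    and v: "v \<in> verts G" "x \<noteq> vertex_point G v"
  shows "\<exists>\<^sub>F n in sequentially. s n \<noteq> v"
proof (rule ccontr)
  assume "\<not> ?thesis"
  then have "\<forall>\<^sub>F n in sequentially. s n = v" by (simp add: frequently_def)
  then have "(\<lambda>n. gdist G (s n) v) \<longlonglongrightarrow> 0"
    by (intro tendsto_eventually) (use gdist_refl[OF v(1)] in \<open>auto elim!: eventually_mono\<close>)
  then have "(s, \<lambda>_. v) \<in> null_rel G"
    using graph_completion_cauchy[OF x s] const_cauchy[OF v(1)] by (simp add: null_rel_def)
  then have "vertex_point G v = x"
    using quotient_eqI[OF equiv_null_rel x[unfolded graph_completion_def]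
        vertex_point_in[OF v(1), unfolded graph_completion_def] s const_in_vertex_point[OF v(1)]]
    by simp
  then show False using v(2) by simp
qed

text \<open>Growing lists that extend one another have an infinite sequence as their union.
  Everything appended after stage \<open>m\<close> satisfies \<open>P m\<close>, because
  \<open>P\<close> gets stronger with its index.\<close>

lemma ray_limit_of_prefixes:
  fixes f :: "nat \<Rightarrow> 'a list"
  assumes f: "\<And>n. avoiding_walk W (f n)" "\<And>n. n < length (f n)"
    and ext: "\<And>n. \<exists>zs. f (Suc n) = f n @ zs \<and> (\<forall>z\<in>set zs. P n z)"
    and anti: "\<And>m n z. m \<le> n \<Longrightarrow> P n z \<Longrightarrow> P m z"
  shows "\<exists>p. is_path G (Ray p) \<and> p 0 = hd (f 0) \<and> path_edges (Ray p) \<inter> W = {} \<and>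
    (\<forall>m. \<forall>\<^sub>F k in sequentially. P m (p k))"
proof -
  have prefix: "\<exists>zs. f n = f m @ zs \<and> (\<forall>z\<in>set zs. P m z)" if "m \<le> n" for m n
    using that
  proof (induction n rule: dec_induct)
    case base
    show ?case by simp
  next
    case (step n)
    then obtain zs where zs: "f n = f m @ zs" "\<forall>z\<in>set zs. P m z" by auto
    obtain ys where ys: "f (Suc n) = f n @ ys" "\<forall>z\<in>set ys. P n z" using ext by blast
    show ?case
      using zs ys anti step(1) by (intro exI[of _ "zs @ ys"]) auto
  qed
  \<comment> \<open>The diagonal is defined since \<open>k < length (f k)\<close>; by the prefix
    property every later list has the same entry at position \<open>k\<close>.\<close>
  define p where "p k = f k ! k" for k
  have nth: "f n ! k = p k" if "k \<le> n" for k n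
    using prefix[OF that] f(2)[of k] by (auto simp: p_def nth_append)
  have "{p k, p (Suc k)} \<in> edges G - W" for k
    using f(1)[of "Suc k"] f(2)[of "Suc k"] nth[of k "Suc k"] nth[of "Suc k" "Suc k"]
    unfolding avoiding_walk_def successively_conv_nth by force
  moreover have "p k \<in> verts G" for k
    using f(1)[of k] f(2)[of k] nth_mem[of k "f k"] unfolding avoiding_walk_def p_def by blast
  moreover have "p 0 = hd (f 0)"
    using f(2)[of 0] by (simp add: p_def hd_conv_nth)
  moreover have "\<forall>\<^sub>F k in sequentially. P m (p k)" for m
  proof (rule eventually_sequentiallyI)
    \<comment> \<open>From position \<open>length (f m)\<close> on, the entries belong to the part
      appended after stage \<open>m\<close>.\<close>
    fix k assume k: "length (f m) \<le> k"
    then have "m \<le> k" using f(2)[of m] by simp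
    then obtain zs where zs: "f k = f m @ zs" "\<forall>z\<in>set zs. P m z" using prefix by blast
    then have "p k = zs ! (k - length (f m))" "k - length (f m) < length zs"
      using k f(2)[of k] by (auto simp: p_def nth_append)
    then show "P m (p k)" using zs(2) by simp
  qed
  ultimately show ?thesis by (intro exI[of _ p]) auto
qed

text \<open>Since \<open>x\<close> is not a vertex, each vertex \<open>v\<close> close to \<open>x\<close> has another vertex near it that is
still closer to \<open>x\<close>; the short walk between the two has at least one edge, so the concatenation of
these walks is infinite.\<close>

lemma ray_to_nonvertex:
  assumes \<delta>: "0 < \<delta>" "\<forall>u v. {u, v} \<in> W \<longrightarrow> \<delta> \<le> len G u v"
    and x: "x \<in> graph_completion G" "x \<notin> vertex_point G ` verts G"
    and a: "linked W b a" "vdist x a < ennreal \<delta>"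
  shows "\<exists>p. is_path G (Ray p) \<and> p 0 = b \<and> path_edges (Ray p) \<inter> W = {} \<and>
    limitin (ctopology G) (\<lambda>k. vertex_point G (p k)) x sequentially"
proof -
  obtain s where s: "s \<in> x" using graph_completion_nonempty[OF x(1)] by auto
  \<comment> \<open>\<open>e 0 = \<delta>\<close> admits the given vertex \<open>a\<close> as the
    start, \<open>e n \<le> \<delta>\<close> keeps all short walks off \<open>W\<close>, and
    \<open>e n\<close> tends to 0 for the convergence.\<close>
  define e where "e n = \<delta> / real (Suc n)" for n
  have e: "0 < e n" "e n \<le> \<delta>" for n
    using \<delta>(1) by (auto simp: e_def field_simps)
  have e_anti: "e n \<le> e m" if "m \<le> n" for m n
    using \<delta>(1) that by (auto simp: e_def intro!: divide_left_mono)
  have "\<exists>f. \<forall>n. (avoiding_walk W (f n) \<and> hd (f n) = b \<and> n < length (f n) \<and>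
        vdist x (last (f n)) < ennreal (e n)) \<and>
      (\<exists>zs. f (Suc n) = f n @ zs \<and> (\<forall>z\<in>set zs. vdist x z < ennreal (2 * e n)))"
  proof (rule dependent_nat_choice)
    show "\<exists>xs. avoiding_walk W xs \<and> hd xs = b \<and> 0 < length xs \<and> vdist x (last xs) < ennreal (e 0)"
      using a by (auto simp: linked_def e_def avoiding_walk_def)
  next
    fix xs n
    assume xs: "avoiding_walk W xs \<and> hd xs = b \<and> n < length xs \<and> vdist x (last xs) < ennreal (e n)"
    define v where "v = last xs"
    have v: "v \<in> verts G" "xs \<noteq> []" using xs by (auto simp: avoiding_walk_def v_def)
    have "\<forall>\<^sub>F m in sequentially. gdist G (s m) v < ennreal (e n)"
      using order_tendstoD(2)[OF vdist_tendsto[OF x(1) s v(1)]] xs by (simp add: v_def)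
    moreover have "\<forall>\<^sub>F m in sequentially. vdist x (s m) < ennreal (e (Suc n))"
      by (rule eventually_vdist_less[OF x(1) s]) (simp add: e)
    \<comment> \<open>A next vertex different from \<open>v\<close> makes the connecting walk
      contribute at least one edge, so the lists grow at every stage.\<close>
    moreover have "\<exists>\<^sub>F m in sequentially. s m \<noteq> v"
      using frequently_neq_vertex[OF x(1) s v(1)] x(2) v(1) by blast
    ultimately have "\<exists>\<^sub>F m in sequentially. s m \<noteq> v \<and> gdist G (s m) v < ennreal (e n) \<and>
        vdist x (s m) < ennreal (e (Suc n))"
      by (auto elim: frequently_rev_mp eventually_elim2)
    then obtain m where m: "s m \<noteq> v" "gdist G v (s m) < ennreal (e n)"
        "vdist x (s m) < ennreal (e (Suc n))"
      by (auto dest: frequently_ex simp: gdist_commute)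
    obtain ys where ys: "avoiding_walk W ys" "hd ys = v" "last ys = s m"
        "\<forall>z\<in>set ys. gdist G v z < ennreal (e n)"
      using short_walk_avoids[OF \<delta>(2) e(2) m(2)] by auto
    have ne: "ys \<noteq> []" "tl ys \<noteq> []"
      using ys(1-3) m(1) by (auto simp: avoiding_walk_def tl_Nil)
    \<comment> \<open>The factor 2: \<open>z\<close> is within \<open>e n\<close> of
      \<open>v\<close>, and \<open>v\<close> is within \<open>e n\<close> of
      \<open>x\<close>.\<close>
    have close: "vdist x z < ennreal (2 * e n)" if z: "z \<in> set (tl ys)" for z
    proof -
      have z': "z \<in> set ys" using z ne(1) by (simp add: list.set_sel(2))
      then have "z \<in> verts G" using ys(1) by (auto simp: avoiding_walk_def)
      then have "vdist x z \<le> vdist x v + gdist G v z" by (rule vdist_triangle[OF x(1) v(1)])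
      also have "\<dots> < ennreal (e n) + ennreal (e n)"
        using ys(4) z' xs by (intro add_strict_mono) (auto simp: v_def)
      also have "\<dots> = ennreal (2 * e n)"
        using e(1)[of n] by (subst ennreal_plus[symmetric]) auto
      finally show ?thesis .
    qed
    have "avoiding_walk W (xs @ tl ys)" "last (xs @ tl ys) = s m"
      using avoiding_walk_append[of W xs ys] last_append_tl[of xs ys] xs ys v ne by (auto simp: v_def)
    moreover have "Suc n < length (xs @ tl ys)"
      using xs ne by (cases "tl ys") auto
    ultimately show "\<exists>zs. (avoiding_walk W zs \<and> hd zs = b \<and> Suc n < length zs \<and>
        vdist x (last zs) < ennreal (e (Suc n))) \<and>
        (\<exists>ws. zs = xs @ ws \<and> (\<forall>z\<in>set ws. vdist x z < ennreal (2 * e n)))"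
      using xs v(2) m(3) close by (intro exI[of _ "xs @ tl ys"]) auto
  qed
  then obtain f where f: "\<And>n. avoiding_walk W (f n)" "\<And>n. hd (f n) = b" "\<And>n. n < length (f n)"
      "\<And>n. \<exists>zs. f (Suc n) = f n @ zs \<and> (\<forall>z\<in>set zs. vdist x z < ennreal (2 * e n))"
    by blast
  have anti: "vdist x z < ennreal (2 * e m)" if "m \<le> n" "vdist x z < ennreal (2 * e n)" for m n z
    using that(2) by (rule less_le_trans) (use e_anti[OF that(1)] in \<open>auto intro: ennreal_leI\<close>)
  have "\<exists>p. is_path G (Ray p) \<and> p 0 = hd (f 0) \<and> path_edges (Ray p) \<inter> W = {} \<and>
      (\<forall>m. \<forall>\<^sub>F k in sequentially. vdist x (p k) < ennreal (2 * e m))"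
  proof (rule ray_limit_of_prefixes)
    show "avoiding_walk W (f n)" "n < length (f n)"
      "\<exists>zs. f (Suc n) = f n @ zs \<and> (\<forall>z\<in>set zs. vdist x z < ennreal (2 * e n))" for n
      by (fact f)+
    show "vdist x z < ennreal (2 * e m)" if "m \<le> n" "vdist x z < ennreal (2 * e n)" for m n z
      using that by (rule anti)
  qed
  then obtain p where p: "is_path G (Ray p)" "p 0 = b" "path_edges (Ray p) \<inter> W = {}"
      "\<And>m. \<forall>\<^sub>F k in sequentially. vdist x (p k) < ennreal (2 * e m)"
    unfolding f(2) by blast
  have "(\<lambda>n. 2 * e n) \<longlonglongrightarrow> 0"
    unfolding e_def using tendsto_mult[OF tendsto_const[of "2 * \<delta>"] LIMSEQ_inverse_real_of_nat]
    by (simp add: divide_inverse mult.assoc)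
  then have e0: "(\<lambda>n. ennreal (2 * e n)) \<longlonglongrightarrow> 0"
    using tendsto_ennrealI by fastforce
  have "\<forall>\<^sub>F k in sequentially. vdist x (p k) < c" if c: "0 < c" for c
  proof -
    obtain m where "ennreal (2 * e m) < c"
      using order_tendstoD(2)[OF e0 c] by (auto dest: eventually_happens)
    with p(4)[of m] show ?thesis by (auto elim!: eventually_mono)
  qed
  then have "limitin (ctopology G) (\<lambda>k. vertex_point G (p k)) x sequentially"
    using p(1) by (intro limitin_vdist x(1)) auto
  with p show ?thesis by blast
qed

section \<open>Paths between two points of the completion\<close>

text \<open>The base \<open>b\<close> need not be close to \<open>x\<close>; it only has to be
  linked to a vertex \<open>a\<close> that is. Hence the start of the ray can be chosen freely in
  the component, and two rays can be given the same start.\<close>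

lemma link_or_ray [consumes 5, case_names vertex ray]:
  assumes \<delta>: "0 < \<delta>" "\<forall>u v. {u, v} \<in> W \<longrightarrow> \<delta> \<le> len G u v"
    and x: "x \<in> graph_completion G"
    and a: "linked W b a" "vdist x a < ennreal \<delta>"
  obtains (vertex) v where "x = vertex_point G v" "linked W b v"
  | (ray) p where "is_path G (Ray p)" "p 0 = b" "path_edges (Ray p) \<inter> W = {}"
      "limitin (ctopology G) (\<lambda>k. vertex_point G (p k)) x sequentially"
proof (cases "x \<in> vertex_point G ` verts G")
  case True
  then obtain v where v: "x = vertex_point G v" "v \<in> verts G" by auto
  have "gdist G a v < ennreal \<delta>"
    using a v linked_verts[OF a(1)] by (simp add: vdist_vertex_point gdist_commute)
  then have "linked W a v" by (rule linked_if_close[OF \<delta>(2)])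
  with a(1) have "linked W b v" by (rule linked_trans)
  then show thesis using vertex v(1) by blast
next
  case False
  then show thesis using ray_to_nonvertex[OF \<delta> x False a] ray by blast
qed

lemma finite_path_between:
  assumes "linked W u v"
  shows "\<exists>p. is_path G p \<and> goes_from_to G p (vertex_point G u) (vertex_point G v) \<and>
    path_edges p \<inter> W = {}"
proof -
  obtain xs where "avoiding_walk W xs" "hd xs = u" "last xs = v"
    using assms unfolding linked_def by auto
  then show ?thesis by (intro exI[of _ "Finite_path xs"]) (auto simp: avoiding_walk_iff)
qed

text \<open>The first ray is traversed backwards and joined to the second at their common
  start.\<close>

lemma double_ray_between:
  assumes p: "is_path G (Ray p)" "path_edges (Ray p) \<inter> W = {}"
      "limitin (ctopology G) (\<lambda>k. vertex_point G (p k)) x sequentially"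
    and q: "is_path G (Ray q)" "path_edges (Ray q) \<inter> W = {}"
      "limitin (ctopology G) (\<lambda>k. vertex_point G (q k)) y sequentially"
    and eq: "p 0 = q 0"
  shows "\<exists>r. is_path G r \<and> goes_from_to G r x y \<and> path_edges r \<inter> W = {}"
proof -
  define r where "r k = (if 0 \<le> k then q (nat k) else p (nat (- k)))" for k :: int
  have edge: "{r k, r (k + 1)} \<in> edges G - W" for k
  proof (cases "0 \<le> k")
    case True
    then have "{r k, r (k + 1)} = {q (nat k), q (Suc (nat k))}"
      by (simp add: r_def nat_add_distrib)
    then show ?thesis using q(1,2) by auto
  next
    case False
    \<comment> \<open>For \<open>k = -1\<close> the right end is index 0, where \<open>r\<close>
      takes its value from \<open>q\<close>; there \<open>p 0 = q 0\<close> is needed.\<close>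
    define j where "j = nat (- k - 1)"
    have "r k = p (Suc j)" "r (k + 1) = p j"
      using False eq by (auto simp: r_def j_def Suc_nat_eq_nat_zadd1)
    then have "{r k, r (k + 1)} = {p j, p (Suc j)}" by auto
    then show ?thesis using p(1,2) by auto
  qed
  have "range r \<subseteq> verts G" using p(1) q(1) by (auto simp: r_def)
  moreover have "limitin (ctopology G) (\<lambda>k. vertex_point G (r k)) x at_bot"
    unfolding limitin_def
  proof (intro conjI allI impI)
    show "x \<in> topspace (ctopology G)" using p(3) by (simp add: limitin_def)
    fix U assume "openin (ctopology G) U \<and> x \<in> U"
    then obtain N where N: "\<And>k. k \<ge> N \<Longrightarrow> vertex_point G (p k) \<in> U"
      using p(3) by (auto simp: limitin_def eventually_sequentially)
    \<comment> \<open>The \<open>- 1\<close> keeps \<open>k\<close> negative even for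
      \<open>N = 0\<close>, so that \<open>r k\<close> is an entry of \<open>p\<close>.\<close>
    have "vertex_point G (r k) \<in> U" if "k \<le> - int N - 1" for k
      using N[of "nat (- k)"] that by (simp add: r_def)
    then show "\<forall>\<^sub>F k in at_bot. vertex_point G (r k) \<in> U"
      unfolding eventually_at_bot_linorder by blast
  qed
  moreover have "limitin (ctopology G) (\<lambda>k. vertex_point G (r k)) y at_top"
    unfolding limitin_def
  proof (intro conjI allI impI)
    show "y \<in> topspace (ctopology G)" using q(3) by (simp add: limitin_def)
    fix U assume "openin (ctopology G) U \<and> y \<in> U"
    then obtain N where N: "\<And>k. k \<ge> N \<Longrightarrow> vertex_point G (q k) \<in> U"
      using q(3) by (auto simp: limitin_def eventually_sequentially)
    have "vertex_point G (r k) \<in> U" if "k \<ge> int N" for k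
      using N[of "nat k"] that by (simp add: r_def le_nat_iff)
    then show "\<forall>\<^sub>F k in at_top. vertex_point G (r k) \<in> U"
      unfolding eventually_at_top_linorder by blast
  qed
  ultimately show ?thesis
    using edge by (intro exI[of _ "Double_ray r"]) auto
qed

text \<open>Depending on which of \<open>x\<close> and \<open>y\<close> are vertices, the path is a
  walk, a ray or a double ray.\<close>

lemma path_between:
  assumes \<delta>: "0 < \<delta>" "\<forall>u v. {u, v} \<in> W \<longrightarrow> \<delta> \<le> len G u v"
    and x: "x \<in> graph_completion G" "vdist x a < ennreal \<delta>"
    and y: "y \<in> graph_completion G" "vdist y b < ennreal \<delta>"
    and ab: "linked W a b"
  shows "\<exists>p. is_path G p \<and> goes_from_to G p x y \<and> path_edges p \<inter> W = {}"
proof -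
  have "linked W a a" using ab linked_verts linked_refl by blast
  from \<delta> x(1) this x(2) show ?thesis
  proof (cases rule: link_or_ray)
    case (vertex v)
    \<comment> \<open>The route to \<open>y\<close> is based at \<open>v\<close> and thus starts at
      the point \<open>x\<close>.\<close>
    have "linked W v b" using linked_trans[OF linked_sym[OF vertex(2)] ab] .
    from \<delta> y(1) this y(2) show ?thesis
    proof (cases rule: link_or_ray)
      case (vertex w)
      then show ?thesis using finite_path_between \<open>x = vertex_point G v\<close> by blast
    next
      case (ray q)
      then show ?thesis using vertex(1) by (intro exI[of _ "Ray q"]) auto
    qed
  next
    case (ray p)
    note p = ray
    from \<delta> y(1) ab y(2) show ?thesis
    proof (cases rule: link_or_ray)
      case (vertex w)
      \<comment> \<open>The ray \<open>p\<close> starts at \<open>a\<close>, which need not be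
        \<open>w\<close>. A new route towards \<open>x\<close> is therefore based at
        \<open>w\<close>; if it is a ray, it is read as a path from its limit \<open>x\<close> to
        its start.\<close>
      have "linked W w a" using vertex(2) by (rule linked_sym)
      from \<delta> x(1) this x(2) show ?thesis
      proof (cases rule: link_or_ray)
        case (vertex v)
        then show ?thesis
          using finite_path_between linked_sym \<open>y = vertex_point G w\<close> by blast
      next
        case (ray q)
        then show ?thesis using vertex(1) by (intro exI[of _ "Ray q"]) auto
      qed
    next
      case (ray q)
      then show ?thesis using double_ray_between[of p W x q y] p by auto
    qed
  qed
qed

text \<open>The triangle inequality would only bound the distance of \<open>u\<close> and
  \<open>v\<close> by twice \<open>\<delta>\<close>. Both, however, are closer than
  \<open>\<delta>\<close> to a common late term of a sequence representing \<open>x\<close>.\<close>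

lemma linked_if_near:
  assumes \<delta>: "\<forall>u v. {u, v} \<in> W \<longrightarrow> \<delta> \<le> len G u v"
    and x: "x \<in> graph_completion G"
    and u: "u \<in> verts G" "vdist x u < ennreal \<delta>"
    and v: "v \<in> verts G" "vdist x v < ennreal \<delta>"
  shows "linked W u v"
proof -
  obtain s where s: "s \<in> x" using graph_completion_nonempty[OF x] by auto
  have "\<forall>\<^sub>F n in sequentially. gdist G (s n) u < ennreal \<delta> \<and> gdist G (s n) v < ennreal \<delta>"
    by (intro eventually_conj order_tendstoD(2)[OF vdist_tendsto[OF x s]] u v)
  then obtain n where "gdist G (s n) u < ennreal \<delta>" "gdist G (s n) v < ennreal \<delta>"
    by (auto dest: eventually_happens)
  then have "linked W (s n) u" "linked W (s n) v" using linked_if_close[OF \<delta>] by auto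
  then show ?thesis using linked_trans[OF linked_sym] by blast
qed

section \<open>Continuous extensions as limits over vertices\<close>

lemma continuous_extension:
  assumes "\<phi> \<in> test_algebra G"
  shows "continuous_map (ctopology G) euclideanreal (continuous_extension G \<phi>)"
    "v \<in> verts G \<Longrightarrow> continuous_extension G \<phi> (vertex_point G v) = \<phi> v"
  using theI'[OF continuous_extension_ex1[OF assms]] unfolding continuous_extension_def by auto

text \<open>The filter is arbitrary so as to cover representing sequences, rays and both ends of
  double rays.\<close>

lemma continuous_extension_limitin:
  assumes "\<phi> \<in> test_algebra G" "\<And>k. p k \<in> verts G"
    and "limitin (ctopology G) (\<lambda>k. vertex_point G (p k)) x F"
  shows "((\<lambda>k. \<phi> (p k)) \<longlongrightarrow> continuous_extension G \<phi> x) F"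
proof -
  have "limitin euclideanreal (continuous_extension G \<phi> \<circ> (\<lambda>k. vertex_point G (p k)))
      (continuous_extension G \<phi> x) F"
    by (rule continuous_map_limit[OF continuous_extension(1)[OF assms(1)] assms(3)])
  then show ?thesis
    using continuous_extension(2)[OF assms(1,2)] by (simp add: o_def)
qed

lemma continuous_extension_tendsto:
  assumes "\<phi> \<in> test_algebra G" "x \<in> graph_completion G" "s \<in> x"
  shows "(\<lambda>n. \<phi> (s n)) \<longlonglongrightarrow> continuous_extension G \<phi> x"
  by (intro continuous_extension_limitin vertex_point_limit assms)
    (use assms in \<open>blast intro: cauchy_seqs_verts graph_completion_cauchy\<close>)

section \<open>Weak connectedness yields separating functions\<close>

lemma separating_function:
  assumes "weakly_connected G"
    and x: "x \<in> graph_completion G" and y: "y \<in> graph_completion G" and "x \<noteq> y"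
  shows "\<exists>\<phi>\<in>test_algebra G. continuous_extension G \<phi> ` graph_completion G = {0, 1} \<and>
    (\<exists>U V. openin (ctopology G) U \<and> x \<in> U \<and> (\<forall>z\<in>U. continuous_extension G \<phi> z = 0) \<and>
           openin (ctopology G) V \<and> y \<in> V \<and> (\<forall>z\<in>V. continuous_extension G \<phi> z = 1))"
proof -
  obtain W where W: "W \<subseteq> edges G" "finite W"
      "\<And>p. is_path G p \<Longrightarrow> goes_from_to G p x y \<Longrightarrow> path_edges p \<inter> W \<noteq> {}"
    using assms unfolding weakly_connected_def by metis
  obtain \<delta> where \<delta>: "0 < \<delta>" "\<forall>u v. {u, v} \<in> W \<longrightarrow> \<delta> \<le> len G u v"
    using finite_edges_len_bound[OF W(2,1)] by auto
  obtain s t where s: "s \<in> x" and t: "t \<in> y"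
    using graph_completion_nonempty[OF x] graph_completion_nonempty[OF y] by auto
  have sv: "s n \<in> verts G" and tv: "t n \<in> verts G" for n
    using cauchy_seqs_verts graph_completion_cauchy x y s t by blast+
  have s_near: "\<forall>\<^sub>F n in sequentially. vdist x (s n) < ennreal \<delta>"
    by (rule eventually_vdist_less[OF x s]) (simp add: \<delta>(1))
  have t_near: "\<forall>\<^sub>F n in sequentially. vdist y (t n) < ennreal \<delta>"
    by (rule eventually_vdist_less[OF y t]) (simp add: \<delta>(1))
  obtain a where a: "a \<in> verts G" "vdist x a < ennreal \<delta>"
    using eventually_happens'[OF sequentially_bot s_near] sv by blast
  define \<phi> where "\<phi> v = (if linked W a v then 0 else 1 :: real)" for v
  \<comment> \<open>An edge outside \<open>W\<close> has both ends or neither in the component of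
    \<open>a\<close>, so \<open>\<phi>\<close> can only change across the finitely many edges of
    \<open>W\<close>.\<close>
  have "\<phi> u = \<phi> v" if "{u, v} \<in> edges G" "{u, v} \<notin> W" for u v
    using linked_edge[OF that] linked_sym linked_trans unfolding \<phi>_def by metis
  then have \<phi>: "\<phi> \<in> test_algebra G"
    unfolding test_algebra_def by (auto intro!: finite_subset[OF _ W(2)])
  define g where "g = continuous_extension G \<phi>"
  have g: "(\<lambda>n. \<phi> (r n)) \<longlonglongrightarrow> g z" if "z \<in> graph_completion G" "r \<in> z" for z r
    unfolding g_def by (rule continuous_extension_tendsto[OF \<phi> that])
  have range: "g z \<in> {0, 1}" if z: "z \<in> graph_completion G" for z
  proof -
    obtain r where r: "r \<in> z" using graph_completion_nonempty[OF z] by auto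
    \<comment> \<open>Limits of 0-1 valued sequences stay in this closed set.\<close>
    have "closed {0, 1 :: real}" by (simp add: finite_imp_closed)
    then show ?thesis
      by (rule closed_sequentially[OF _ _ g[OF z r]]) (simp add: \<phi>_def)
  qed
  have "\<forall>\<^sub>F n in sequentially. \<phi> (s n) = 0"
    using s_near by eventually_elim (simp add: \<phi>_def linked_if_near[OF \<delta>(2) x a sv])
  then have gx: "g x = 0" by (rule LIMSEQ_unique[OF g[OF x s] tendsto_eventually])
  \<comment> \<open>Were such a \<open>t n\<close> linked to \<open>a\<close>, then
    \<open>path_between\<close> would give a path from \<open>x\<close> to \<open>y\<close> that
    misses \<open>W\<close>.\<close>
  have "\<forall>\<^sub>F n in sequentially. \<phi> (t n) = 1"
    using t_near by eventually_elim (use W(3) path_between[OF \<delta> x a(2) y] in \<open>auto simp: \<phi>_def\<close>)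
  then have gy: "g y = 1" by (rule LIMSEQ_unique[OF g[OF y t] tendsto_eventually])
  have op: "openin (ctopology G) {z \<in> graph_completion G. g z \<in> S}" if "open S" for S
    using openin_continuous_map_preimage[OF continuous_extension(1)[OF \<phi>], of S] that
    by (simp add: g_def topspace_ctopology)
  \<comment> \<open>As \<open>g\<close> takes no values besides 0 and 1, these open preimages are
    exactly its two level sets.\<close>
  have U: "openin (ctopology G) {z \<in> graph_completion G. g z \<in> {..<1}}"
    and V: "openin (ctopology G) {z \<in> graph_completion G. g z \<in> {0<..}}"
    by (rule op, simp)+
  have "g ` graph_completion G = {0, 1}"
    using range x y gx gy by (auto intro: rev_image_eqI)
  moreover have "\<exists>U V. openin (ctopology G) U \<and> x \<in> U \<and> (\<forall>z\<in>U. g z = 0) \<and>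
      openin (ctopology G) V \<and> y \<in> V \<and> (\<forall>z\<in>V. g z = 1)"
    by (rule exI, rule exI, intro conjI, rule U, simp add: x gx, use range in force,
        rule V, simp add: y gy, use range in force)
  ultimately show ?thesis using \<phi> unfolding g_def by blast
qed

section \<open>Separating functions yield weak connectedness\<close>

text \<open>The bound \<open>n\<close> serves lists, where \<open>n\<close> is the length; for a ray
  it is set to \<open>Suc k\<close>.\<close>

lemma nat_steps_const:
  assumes "\<And>k. Suc k < n \<Longrightarrow> f k = f (Suc k)" "k < n"
  shows "f k = f 0"
  using assms(2) by (induction k) (use assms(1) in auto)

lemma int_steps_const:
  fixes f :: "int \<Rightarrow> 'b"
  assumes "\<And>k. f k = f (k + 1)"
  shows "f k = f 0"
  by (induction k rule: int_induct[where k = 0]) (use assms in \<open>auto, metis diff_add_cancel\<close>)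

lemma extension_eq_along_path:
  assumes \<phi>: "\<phi> \<in> test_algebra G" and p: "is_path G p" "goes_from_to G p x y"
    and const: "\<And>u v. {u, v} \<in> path_edges p \<Longrightarrow> \<phi> u = \<phi> v"
  shows "continuous_extension G \<phi> x = continuous_extension G \<phi> y"
proof (cases p)
  case (Finite_path xs)
  have xs: "xs \<noteq> []" "hd xs \<in> verts G" "last xs \<in> verts G"
    using p Finite_path by (auto simp: walk_def)
  have "\<phi> (xs ! k) = \<phi> (xs ! 0)" if "k < length xs" for k
    by (rule nat_steps_const[OF _ that]) (use const Finite_path in auto)
  from this[of "length xs - 1"] have "\<phi> (last xs) = \<phi> (hd xs)"
    using xs by (simp add: hd_conv_nth last_conv_nth)
  then show ?thesis
    using p Finite_path xs continuous_extension(2)[OF \<phi>] by auto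
next
  case (Ray q)
  have q: "q k \<in> verts G" for k using p Ray by auto
  have "\<phi> (q k) = \<phi> (q 0)" for k
    by (rule nat_steps_const[of "Suc k"]) (use const Ray in auto)
  then have c: "(\<lambda>k. \<phi> (q k)) = (\<lambda>_. \<phi> (q 0))" by blast
  \<comment> \<open>Here \<open>z\<close> stands for either end, since a ray may converge to
    \<open>x\<close> or to \<open>y\<close>.\<close>
  have "continuous_extension G \<phi> z = continuous_extension G \<phi> (vertex_point G (q 0))"
    if "limitin (ctopology G) (\<lambda>k. vertex_point G (q k)) z sequentially" for z
    using continuous_extension_limitin[OF \<phi> q that] continuous_extension(2)[OF \<phi> q]
    unfolding c by (simp add: LIMSEQ_const_iff)
  then show ?thesis using p(2) Ray by auto
next
  case (Double_ray q)
  have q: "q k \<in> verts G" for k using p Double_ray by auto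
  have "\<phi> (q k) = \<phi> (q 0)" for k
    by (rule int_steps_const) (use const Double_ray in auto)
  then have c: "(\<lambda>k. \<phi> (q k)) = (\<lambda>_. \<phi> (q 0))" by blast
  have "((\<lambda>k. \<phi> (q k)) \<longlongrightarrow> continuous_extension G \<phi> x) at_bot"
    "((\<lambda>k. \<phi> (q k)) \<longlongrightarrow> continuous_extension G \<phi> y) at_top"
    using p(2) Double_ray by (auto intro!: continuous_extension_limitin[OF \<phi> q])
  then show ?thesis unfolding c by (simp add: tendsto_const_iff)
qed

lemma separates_points_imp_weakly_connected:
  assumes "separates_points G"
  shows "weakly_connected G"
  unfolding weakly_connected_def
proof (intro ballI impI)
  fix x y assume xy: "x \<in> graph_completion G" "y \<in> graph_completion G" "x \<noteq> y"
  then obtain \<phi> where \<phi>: "\<phi> \<in> test_algebra G"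
      "continuous_extension G \<phi> x \<noteq> continuous_extension G \<phi> y"
    using assms unfolding separates_points_def by blast
  define W where "W = {e \<in> edges G. \<exists>u v. e = {u, v} \<and> \<phi> u \<noteq> \<phi> v}"
  have "path_edges p \<inter> W \<noteq> {}" if p: "is_path G p" "goes_from_to G p x y" for p
  proof
    assume W: "path_edges p \<inter> W = {}"
    \<comment> \<open>\<open>W\<close> contains only edges of the graph, so missing \<open>W\<close>
      gives constancy only across pairs known to be edges.\<close>
    have "path_edges p \<subseteq> edges G" using p(1) by (cases p) (auto simp: walk_def)
    then have "\<phi> u = \<phi> v" if "{u, v} \<in> path_edges p" for u v
      using W that unfolding W_def by blast
    then show False using extension_eq_along_path[OF \<phi>(1) p] \<phi>(2) by blast
  qed
  moreover have "finite W" "W \<subseteq> edges G" using \<phi>(1) by (auto simp: W_def test_algebra_def)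
  ultimately show "\<exists>W\<subseteq>edges G. finite W \<and>
      (\<forall>p. is_path G p \<and> goes_from_to G p x y \<longrightarrow> path_edges p \<inter> W \<noteq> {})"
    by blast
qed

end

theorem theorem2p10:
  fixes G :: "'a wgraph"
  assumes "weighted_graph G"
  shows "(weakly_connected G \<longrightarrow>
      (\<forall>x\<in>graph_completion G. \<forall>y\<in>graph_completion G. x \<noteq> y \<longrightarrow>
        (\<exists>\<phi>\<in>test_algebra G. continuous_extension G \<phi> ` graph_completion G = {0, 1} \<and>
          (\<exists>U V. openin (ctopology G) U \<and> x \<in> U \<and> (\<forall>z\<in>U. continuous_extension G \<phi> z = 0) \<and>
                 openin (ctopology G) V \<and> y \<in> V \<and> (\<forall>z\<in>V. continuous_extension G \<phi> z = 1)))))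
    \<and> (separates_points G \<longrightarrow> weakly_connected G)"
proof -
  interpret weighted_graph G by fact
  show ?thesis
    using separating_function separates_points_imp_weakly_connected by blast
qed

end
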